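(* Let a signal $y$ be given by $$y=a\cos(x)+b\sin(x)+e,\qquad e\sim\mathcal N(0,\sigma^2),\qquad a=\alpha^{\mathsf T}\phi,\quad b=\beta^{\mathsf T}\phi,$$ with $\phi=\phi(v)\in\mathbb{R}^J$ and $\alpha,\beta\in\mathbb{R}^J$, and let $\hat\alpha$ and $\hat\beta$ denote unbiased estimates of $\alpha$ and $\beta$, with covariance matrices $\Sigma_\alpha$ and $\Sigma_\beta$ respectively. Then $$\hat A(\hat\alpha,\hat\beta)=\sqrt{\left(\hat\alpha^{\mathsf T}\phi\right)^2+\left(\hat\beta^{\mathsf T}\phi\right)^2}$$ has an expected value with lower and upper bounds given by $$A<\mathbb{E}\{\hat A\}<\sqrt{A^2+\phi^{\mathsf T}\Sigma_\alpha\phi+\phi^{\mathsf T}\Sigma_\beta\phi},$$ where $A=\sqrt{(\alpha^{\mathsf T}\phi)^2+(\beta^{\mathsf T}\phi)^2}$.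
   Context: Here $v$ is a (known, deterministic) scheduling variable, and $\phi(v)=\begin{bmatrix}\kappa_1(v)&\cdots&\kappa_J(v)\end{bmatrix}^{\mathsf T}\in\mathbb{R}^J$ is a known vector of basis-function activations (for example Gaussian radial basis functions $\kappa_j(v)=\exp(-(v-\mu_j)^2/(2\sigma_j^2))$), evaluated at $v$. $A$ is the true amplitude of the sinusoid $a\cos(x)+b\sin(x)$. The estimates $\hat\alpha,\hat\beta$ are random vectors in $\mathbb{R}^J$ with $\mathbb{E}\{\hat\alpha\}=\alpha$, $\mathbb{E}\{\hat\beta\}=\beta$.
   Formalization: The strict bounds fail in degenerate cases (e.g. estimates a.s. equal to α, β); proved are both bounds with ≤, the lower strict iff (α̂ᵀφ, β̂ᵀφ) is not a.s. on one fixed ray from the origin, the upper strict iff Â is not a.s. constant. *)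

theory Defs
  imports "HOL-Probability.Probability"
begin

definition activation :: "('j::finite \<Rightarrow> 'v \<Rightarrow> real) \<Rightarrow> 'v \<Rightarrow> real ^ 'j" where
  "activation \<kappa> v = (\<chi> j. \<kappa> j v)"

text \<open>Amplitude of the sinusoid a cos x + b sin x, where a and b are the linear combinations of the
  activations \<open>\<phi>\<close> with weights \<open>\<alpha>\<close> and \<open>\<beta>\<close>. The same function of the weights gives the true amplitude
  and, applied to the estimated weights, the amplitude estimate.\<close>

definition amplitude :: "real ^ 'j \<Rightarrow> real ^ 'j \<Rightarrow> real ^ 'j \<Rightarrow> real" where
  "amplitude \<phi> \<alpha> \<beta> = sqrt ((\<alpha> \<bullet> \<phi>)\<^sup>2 + (\<beta> \<bullet> \<phi>)\<^sup>2)"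

text \<open>Integrability is required explicitly because the Bochner integral of a non-integrable
  function is 0.\<close>

definition unbiased_estimate :: "'a measure \<Rightarrow> ('a \<Rightarrow> real ^ 'j) \<Rightarrow> real ^ 'j \<Rightarrow> bool" where
  "unbiased_estimate M X \<theta> \<longleftrightarrow> integrable M X \<and> integral\<^sup>L M X = \<theta>"

definition has_covariance_matrix ::
    "'a measure \<Rightarrow> ('a \<Rightarrow> real ^ 'j) \<Rightarrow> real ^ 'j ^ 'j \<Rightarrow> bool" where
  "has_covariance_matrix M X \<Sigma> \<longleftrightarrow>
     X \<in> borel_measurable M \<and>
     (\<forall>i. integrable M (\<lambda>\<omega>. (X \<omega> $ i)\<^sup>2)) \<and>
     (\<forall>i j. \<Sigma> $ i $ j =
        (\<integral>\<omega>. (X \<omega> $ i - integral\<^sup>L M X $ i) * (X \<omega> $ j - integral\<^sup>L M X $ j) \<partial>M))"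

text \<open>The estimated sinusoid, written as its amplitude times cos (x - \<open>\<psi>\<close>), has almost surely one
  and the same phase \<open>\<psi>\<close>. The phase of the zero sinusoid is arbitrary.\<close>

definition deterministic_phase ::
    "'a measure \<Rightarrow> real ^ 'j \<Rightarrow> ('a \<Rightarrow> real ^ 'j) \<Rightarrow> ('a \<Rightarrow> real ^ 'j) \<Rightarrow> bool" where
  "deterministic_phase M \<phi> X Y \<longleftrightarrow>
     (\<exists>\<psi>. AE \<omega> in M. X \<omega> \<bullet> \<phi> = amplitude \<phi> (X \<omega>) (Y \<omega>) * cos \<psi> \<and>
                    Y \<omega> \<bullet> \<phi> = amplitude \<phi> (X \<omega>) (Y \<omega>) * sin \<psi>)"

definition deterministic_amplitude ::
    "'a measure \<Rightarrow> real ^ 'j \<Rightarrow> ('a \<Rightarrow> real ^ 'j) \<Rightarrow> ('a \<Rightarrow> real ^ 'j) \<Rightarrow> bool" where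
  "deterministic_amplitude M \<phi> X Y \<longleftrightarrow> (\<exists>c. AE \<omega> in M. amplitude \<phi> (X \<omega>) (Y \<omega>) = c)"

end

theory Submission
  imports Defs
begin

text \<open>Write \<open>P = \<alpha>_hat \<bullet> \<phi>\<close>, \<open>Q = \<beta>_hat \<bullet> \<phi>\<close> and \<open>R = sqrt (P\<^sup>2 + Q\<^sup>2)\<close>. If \<open>\<psi>\<close> is the phase
  of the mean vector \<open>(E P, E Q)\<close>, then \<open>A = E (P cos \<psi> + Q sin \<psi>) \<le> E R\<close>, with equality iff the
  projection of \<open>(P, Q)\<close> on the direction \<open>\<psi>\<close> is almost surely its full length. The quadratic
  forms in the upper bound are the variances of \<open>P\<close> and \<open>Q\<close>, so the radicand is \<open>E R\<^sup>2\<close>, and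
  \<open>E R\<^sup>2 - (E R)\<^sup>2\<close> is the variance of \<open>R\<close>, which vanishes iff \<open>R\<close> is almost surely constant.\<close>

section \<open>Plane geometry: the length of a vector and its projections\<close>

text \<open>The right-hand side is the squared distance from \<open>(p, q)\<close> to the point of
  direction \<open>\<psi>\<close> on the same circle about 0, and the identity is the law of cosines
  for two vectors of length \<open>r\<close>. Its sign yields the projection inequality and its
  zeros yield the equality case.\<close>

lemma projection_defect_times_sqrt_sum_squares:
  fixes p q \<psi> :: real
  defines "r \<equiv> sqrt (p\<^sup>2 + q\<^sup>2)"
  shows "(r - (p * cos \<psi> + q * sin \<psi>)) * 2 * r = (p - r * cos \<psi>)\<^sup>2 + (q - r * sin \<psi>)\<^sup>2"
proof -
  have "r\<^sup>2 = p\<^sup>2 + q\<^sup>2"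
    unfolding r_def by simp
  moreover have "(p - r * cos \<psi>)\<^sup>2 + (q - r * sin \<psi>)\<^sup>2
      = p\<^sup>2 + q\<^sup>2 + r\<^sup>2 * ((cos \<psi>)\<^sup>2 + (sin \<psi>)\<^sup>2) - 2 * r * (p * cos \<psi> + q * sin \<psi>)"
    by (simp only: power2_eq_square) (simp only: algebra_simps)
  ultimately have "(p - r * cos \<psi>)\<^sup>2 + (q - r * sin \<psi>)\<^sup>2
      = r\<^sup>2 + r\<^sup>2 - 2 * r * (p * cos \<psi> + q * sin \<psi>)"
    by simp
  then show ?thesis
    by (simp only: power2_eq_square left_diff_distrib) (simp only: mult_ac mult_2_right distrib_left)
qed

lemma projection_le_sqrt_sum_squares:
  fixes p q \<psi> :: real
  shows "p * cos \<psi> + q * sin \<psi> \<le> sqrt (p\<^sup>2 + q\<^sup>2)"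
proof (cases "sqrt (p\<^sup>2 + q\<^sup>2) = 0")
  \<comment> \<open>The identity determines the defect only after cancelling \<open>r\<close>, so
    the zero vector is treated separately.\<close>
  case True
  then show ?thesis by (simp add: sum_power2_eq_zero_iff)
next
  case False
  then have "sqrt (p\<^sup>2 + q\<^sup>2) > 0"
    by (simp add: less_le)
  moreover have "(sqrt (p\<^sup>2 + q\<^sup>2) - (p * cos \<psi> + q * sin \<psi>)) * 2 * sqrt (p\<^sup>2 + q\<^sup>2) \<ge> 0"
    unfolding projection_defect_times_sqrt_sum_squares by simp
  ultimately show ?thesis
    by (simp add: zero_le_mult_iff)
qed

text \<open>A vanishing defect makes the squared distance zero. Nothing is divided by the length, so
  the zero vector is covered as well.\<close>

lemma projection_eq_sqrt_sum_squaresD: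
  fixes p q \<psi> :: real
  assumes "p * cos \<psi> + q * sin \<psi> = sqrt (p\<^sup>2 + q\<^sup>2)"
  shows "p = sqrt (p\<^sup>2 + q\<^sup>2) * cos \<psi>" and "q = sqrt (p\<^sup>2 + q\<^sup>2) * sin \<psi>"
proof -
  have "(p - sqrt (p\<^sup>2 + q\<^sup>2) * cos \<psi>)\<^sup>2 + (q - sqrt (p\<^sup>2 + q\<^sup>2) * sin \<psi>)\<^sup>2 = 0"
    unfolding projection_defect_times_sqrt_sum_squares[symmetric] assms by simp
  then show "p = sqrt (p\<^sup>2 + q\<^sup>2) * cos \<psi>" and "q = sqrt (p\<^sup>2 + q\<^sup>2) * sin \<psi>"
    by (simp_all only: sum_power2_eq_zero_iff right_minus_eq)
qed

lemma sqrt_sum_squares_polar: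
  fixes p q :: real
  obtains \<psi> where "p = sqrt (p\<^sup>2 + q\<^sup>2) * cos \<psi>" and "q = sqrt (p\<^sup>2 + q\<^sup>2) * sin \<psi>"
proof (cases "sqrt (p\<^sup>2 + q\<^sup>2) = 0")
  case True
  \<comment> \<open>Any phase fits the zero vector; 0 is an arbitrary choice.\<close>
  then show thesis
    using that[of 0] by (simp add: sum_power2_eq_zero_iff)
next
  case False
  define r where "r = sqrt (p\<^sup>2 + q\<^sup>2)"
  have "r \<noteq> 0" and "r\<^sup>2 = p\<^sup>2 + q\<^sup>2"
    using False by (simp_all add: r_def)
  then have "(p / r)\<^sup>2 + (q / r)\<^sup>2 = r\<^sup>2 / r\<^sup>2"
    by (simp only: power_divide add_divide_distrib)
  then have "(p / r)\<^sup>2 + (q / r)\<^sup>2 = 1"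
    using \<open>r \<noteq> 0\<close> by simp
  then obtain \<psi> where "p / r = cos \<psi>" and "q / r = sin \<psi>"
    by (rule sincos_total_2pi)
  then have "p = cos \<psi> * r" and "q = sin \<psi> * r"
    using \<open>r \<noteq> 0\<close> by (simp_all add: nonzero_divide_eq_eq)
  then show thesis
    using that unfolding r_def mult.commute[of _ "sqrt _"] by blast
qed

section \<open>Integrability and strict comparison of integrals\<close>

lemma integrable_sqrt_sum_squares:
  fixes P Q :: "'a \<Rightarrow> real"
  assumes "integrable M P" and "integrable M Q"
  shows "integrable M (\<lambda>\<omega>. sqrt ((P \<omega>)\<^sup>2 + (Q \<omega>)\<^sup>2))"
proof (rule Bochner_Integration.integrable_bound)
  have [measurable]: "P \<in> borel_measurable M" "Q \<in> borel_measurable M"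
    using assms by simp_all
  show "(\<lambda>\<omega>. sqrt ((P \<omega>)\<^sup>2 + (Q \<omega>)\<^sup>2)) \<in> borel_measurable M"
    by measurable
  show "integrable M (\<lambda>\<omega>. \<bar>P \<omega>\<bar> + \<bar>Q \<omega>\<bar>)"
    using assms by auto
  show "AE \<omega> in M. norm (sqrt ((P \<omega>)\<^sup>2 + (Q \<omega>)\<^sup>2)) \<le> norm (\<bar>P \<omega>\<bar> + \<bar>Q \<omega>\<bar>)"
    by (simp add: sqrt_sum_squares_le_sum_abs)
qed

text \<open>The difference \<open>g - f\<close> is almost everywhere non-negative, so its integral
  vanishes only if it is almost everywhere zero. This decides when the lower bound is
  strict.\<close>

lemma integral_less_iff_not_AE_eq:
  fixes f g :: "'a \<Rightarrow> real"
  assumes "integrable M f" and "integrable M g" and "AE \<omega> in M. f \<omega> \<le> g \<omega>"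
  shows "integral\<^sup>L M f < integral\<^sup>L M g \<longleftrightarrow> \<not> (AE \<omega> in M. f \<omega> = g \<omega>)"
proof -
  have "integral\<^sup>L M (\<lambda>\<omega>. g \<omega> - f \<omega>) = 0 \<longleftrightarrow> (AE \<omega> in M. g \<omega> - f \<omega> = 0)"
    using assms by (intro integral_nonneg_eq_0_iff_AE) auto
  also have "\<dots> \<longleftrightarrow> (AE \<omega> in M. f \<omega> = g \<omega>)"
    by (rule AE_cong) auto
  finally have "integral\<^sup>L M g - integral\<^sup>L M f = 0 \<longleftrightarrow> (AE \<omega> in M. f \<omega> = g \<omega>)"
    using assms by simp
  moreover have "integral\<^sup>L M f \<le> integral\<^sup>L M g"
    using assms by (rule integral_mono_AE)
  ultimately show ?thesis
    by linarith
qed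

lemma integrable_product_of_square_integrable:
  fixes f g :: "'a \<Rightarrow> real"
  assumes [measurable]: "f \<in> borel_measurable M" "g \<in> borel_measurable M"
    and "integrable M (\<lambda>\<omega>. (f \<omega>)\<^sup>2)" and "integrable M (\<lambda>\<omega>. (g \<omega>)\<^sup>2)"
  shows "integrable M (\<lambda>\<omega>. f \<omega> * g \<omega>)"
proof (rule Bochner_Integration.integrable_bound)
  show "integrable M (\<lambda>\<omega>. (f \<omega>)\<^sup>2 + (g \<omega>)\<^sup>2)"
    using assms by simp
  \<comment> \<open>The arithmetic-geometric mean inequality for absolute values, with a factor 2
    given away: domination needs no sharp constant.\<close>
  have "\<bar>s * t\<bar> \<le> s\<^sup>2 + t\<^sup>2" for s t :: real
    using sum_squares_bound[of "\<bar>s\<bar>" "\<bar>t\<bar>"] abs_ge_zero[of "s * t"]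
    unfolding abs_mult power2_abs by linarith
  then show "AE \<omega> in M. norm (f \<omega> * g \<omega>) \<le> norm ((f \<omega>)\<^sup>2 + (g \<omega>)\<^sup>2)"
    by simp
qed measurable

section \<open>Moments of random variables and random vectors\<close>

context prob_space
begin

lemma variance_eq_0_iff_AE_const:
  fixes X :: "'a \<Rightarrow> real"
  assumes "integrable M X" and "integrable M (\<lambda>\<omega>. (X \<omega>)\<^sup>2)"
  shows "variance X = 0 \<longleftrightarrow> (\<exists>c. AE \<omega> in M. X \<omega> = c)"
proof
  have "integrable M (\<lambda>\<omega>. (X \<omega> - expectation X)\<^sup>2)"
    using assms by (simp add: power2_diff)
  then have eq: "variance X = 0 \<longleftrightarrow> (AE \<omega> in M. X \<omega> = expectation X)"
    by (subst integral_nonneg_eq_0_iff_AE) auto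
  {
    assume "variance X = 0"
    then show "\<exists>c. AE \<omega> in M. X \<omega> = c"
      using eq by blast
  next
    assume "\<exists>c. AE \<omega> in M. X \<omega> = c"
    then obtain c where c: "AE \<omega> in M. X \<omega> = c" ..
    \<comment> \<open>On a probability space the constant can only be the mean, which reduces this
      direction to \<open>eq\<close>.\<close>
    then have "expectation X = expectation (\<lambda>_. c)"
      using assms by (intro integral_cong_AE) auto
    with c show "variance X = 0"
      unfolding eq by (simp add: prob_space)
  }
qed

text \<open>The quadratic form is the variance of the scalar
  \<open>X \<omega> \<bullet> \<phi>\<close>: the square of a linear combination is a double sum
  over pairs of components, and expectation acts on it term by term.\<close>

lemma
  assumes cov: "has_covariance_matrix M X \<Sigma>" and unb: "unbiased_estimate M X \<theta>"
  shows integrable_square_inner: "integrable M (\<lambda>\<omega>. (X \<omega> \<bullet> \<phi>)\<^sup>2)"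
    and covariance_quadratic_form:
      "\<phi> \<bullet> (\<Sigma> *v \<phi>) = expectation (\<lambda>\<omega>. (X \<omega> \<bullet> \<phi>)\<^sup>2) - (\<theta> \<bullet> \<phi>)\<^sup>2"
proof -
  have X [measurable]: "X \<in> borel_measurable M"
    and sq: "\<And>i. integrable M (\<lambda>\<omega>. (X \<omega> $ i)\<^sup>2)"
    and int: "integrable M X" and mean: "integral\<^sup>L M X = \<theta>"
    and \<Sigma>: "\<And>i j. \<Sigma> $ i $ j = expectation (\<lambda>\<omega>. (X \<omega> $ i - \<theta> $ i) * (X \<omega> $ j - \<theta> $ j))"
    using cov unb by (auto simp: has_covariance_matrix_def unbiased_estimate_def)
  have comp_int: "integrable M (\<lambda>\<omega>. X \<omega> $ i)" for i
    using integrable_inner_left[OF int, of "axis i 1"] by (simp add: inner_axis)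
  have comp [measurable]: "(\<lambda>\<omega>. X \<omega> $ i) \<in> borel_measurable M" for i
    using comp_int by simp
  \<comment> \<open>This permits exchanging expectation with the double sum below.\<close>
  have dev: "integrable M (\<lambda>\<omega>. (X \<omega> $ i - \<theta> $ i) * (X \<omega> $ j - \<theta> $ j))" for i j
    by (rule integrable_product_of_square_integrable)
      (simp_all add: power2_diff sq comp_int)
  have inner_int: "integrable M (\<lambda>\<omega>. X \<omega> \<bullet> \<phi>)"
    using int by simp
  have inner_mean: "expectation (\<lambda>\<omega>. X \<omega> \<bullet> \<phi>) = \<theta> \<bullet> \<phi>"
    using int mean by simp
  have prod: "integrable M (\<lambda>\<omega>. X \<omega> $ i * X \<omega> $ j)" for i j
    by (rule integrable_product_of_square_integrable) (simp_all add: sq)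
  \<comment> \<open>A general \<open>z\<close> serves twice: \<open>X \<omega>\<close> for
    integrability and \<open>X \<omega> - \<theta>\<close> for the variance.\<close>
  have expand: "(z \<bullet> \<phi>)\<^sup>2 = (\<Sum>i\<in>UNIV. \<Sum>j\<in>UNIV. (\<phi> $ i * \<phi> $ j) * (z $ i * z $ j))" for z
    by (simp add: inner_vec_def power2_eq_square sum_product mult_ac)
  show sq_int: "integrable M (\<lambda>\<omega>. (X \<omega> \<bullet> \<phi>)\<^sup>2)"
    unfolding expand by (intro Bochner_Integration.integrable_sum integrable_mult_right prod)
  have "variance (\<lambda>\<omega>. X \<omega> \<bullet> \<phi>) = expectation (\<lambda>\<omega>. ((X \<omega> - \<theta>) \<bullet> \<phi>)\<^sup>2)"
    by (simp add: inner_mean inner_diff_left)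
  also have "\<dots> = (\<Sum>i\<in>UNIV. \<Sum>j\<in>UNIV. (\<phi> $ i * \<phi> $ j) * \<Sigma> $ i $ j)"
    unfolding expand using dev by (simp add: \<Sigma>)
  also have "\<dots> = \<phi> \<bullet> (\<Sigma> *v \<phi>)"
    by (simp add: inner_vec_def matrix_vector_mult_def sum_distrib_left mult_ac)
  finally show "\<phi> \<bullet> (\<Sigma> *v \<phi>) = expectation (\<lambda>\<omega>. (X \<omega> \<bullet> \<phi>)\<^sup>2) - (\<theta> \<bullet> \<phi>)\<^sup>2"
    using variance_eq[OF inner_int sq_int] by (simp add: inner_mean)
qed

lemma
  fixes P Q :: "'a \<Rightarrow> real"
  assumes P: "integrable M P" and Q: "integrable M Q"
  defines "R \<equiv> \<lambda>\<omega>. sqrt ((P \<omega>)\<^sup>2 + (Q \<omega>)\<^sup>2)"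
  defines "A \<equiv> sqrt ((expectation P)\<^sup>2 + (expectation Q)\<^sup>2)"
  shows expectation_sqrt_sum_squares_ge: "A \<le> expectation R"
    and expectation_sqrt_sum_squares_greater_iff:
      "A < expectation R \<longleftrightarrow>
        \<not> (\<exists>\<psi>. AE \<omega> in M. P \<omega> = R \<omega> * cos \<psi> \<and> Q \<omega> = R \<omega> * sin \<psi>)"
proof -
  have R: "integrable M R"
    unfolding R_def using P Q by (rule integrable_sqrt_sum_squares)
  obtain \<psi> where \<psi>: "expectation P = A * cos \<psi>" "expectation Q = A * sin \<psi>"
    unfolding A_def using sqrt_sum_squares_polar .
  have proj: "integrable M (\<lambda>\<omega>. P \<omega> * cos \<psi> + Q \<omega> * sin \<psi>)"
    using P Q by simp
  have "expectation (\<lambda>\<omega>. P \<omega> * cos \<psi> + Q \<omega> * sin \<psi>)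
      = A * cos \<psi> * cos \<psi> + A * sin \<psi> * sin \<psi>"
    using P Q by (simp add: \<psi>)
  also have "\<dots> = A * ((cos \<psi>)\<^sup>2 + (sin \<psi>)\<^sup>2)"
    by (simp only: power2_eq_square algebra_simps)
  finally have A: "expectation (\<lambda>\<omega>. P \<omega> * cos \<psi> + Q \<omega> * sin \<psi>) = A"
    by simp
  have le: "AE \<omega> in M. P \<omega> * cos \<psi> + Q \<omega> * sin \<psi> \<le> R \<omega>"
    unfolding R_def by (simp add: projection_le_sqrt_sum_squares)
  show ge: "A \<le> expectation R"
    using integral_mono_AE[OF proj R le] by (simp only: A)
  show "A < expectation R \<longleftrightarrow>
      \<not> (\<exists>\<psi>. AE \<omega> in M. P \<omega> = R \<omega> * cos \<psi> \<and> Q \<omega> = R \<omega> * sin \<psi>)"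
  proof
    assume less: "A < expectation R"
    show "\<not> (\<exists>\<psi>. AE \<omega> in M. P \<omega> = R \<omega> * cos \<psi> \<and> Q \<omega> = R \<omega> * sin \<psi>)"
    proof
      assume "\<exists>\<psi>. AE \<omega> in M. P \<omega> = R \<omega> * cos \<psi> \<and> Q \<omega> = R \<omega> * sin \<psi>"
      then obtain \<theta> where \<theta>: "AE \<omega> in M. P \<omega> = R \<omega> * cos \<theta> \<and> Q \<omega> = R \<omega> * sin \<theta>" ..
      \<comment> \<open>The common phase \<open>\<theta>\<close> need not be the chosen
        \<open>\<psi>\<close>. Averaging gives the mean vector polar coordinates
        \<open>expectation R\<close> and \<open>\<theta>\<close>, so its length \<open>A\<close>
        equals \<open>expectation R\<close>.\<close>
      have "expectation P = expectation (\<lambda>\<omega>. R \<omega> * cos \<theta>)"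
        using P R \<theta> by (intro integral_cong_AE) auto
      moreover have "expectation Q = expectation (\<lambda>\<omega>. R \<omega> * sin \<theta>)"
        using Q R \<theta> by (intro integral_cong_AE) auto
      ultimately have "A = sqrt ((expectation R)\<^sup>2 * ((cos \<theta>)\<^sup>2 + (sin \<theta>)\<^sup>2))"
        unfolding A_def by (simp add: power_mult_distrib distrib_left del: sin_cos_squared_add2)
      \<comment> \<open>As \<open>R\<close> is a square root, its mean is non-negative and is the
        root of its own square.\<close>
      also have "\<dots> = expectation R"
        by (simp add: R_def)
      finally show False
        using less by simp
    qed
  next
    assume nphase: "\<not> (\<exists>\<psi>. AE \<omega> in M. P \<omega> = R \<omega> * cos \<psi> \<and> Q \<omega> = R \<omega> * sin \<psi>)"
    \<comment> \<open>Now \<open>\<psi>\<close> is again the phase of the mean: equality along this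
      one direction would already make it a common phase.\<close>
    have "\<not> (AE \<omega> in M. P \<omega> * cos \<psi> + Q \<omega> * sin \<psi> = R \<omega>)"
    proof
      assume "AE \<omega> in M. P \<omega> * cos \<psi> + Q \<omega> * sin \<psi> = R \<omega>"
      then have "AE \<omega> in M. P \<omega> = R \<omega> * cos \<psi> \<and> Q \<omega> = R \<omega> * sin \<psi>"
        unfolding R_def by eventually_elim (blast intro: projection_eq_sqrt_sum_squaresD)
      with nphase show False
        by blast
    qed
    then show "A < expectation R"
      using integral_less_iff_not_AE_eq[OF proj R le] unfolding A by blast
  qed
qed

lemma
  fixes X :: "'a \<Rightarrow> real"
  assumes X: "integrable M X" "integrable M (\<lambda>\<omega>. (X \<omega>)\<^sup>2)" and nonneg: "\<And>\<omega>. X \<omega> \<ge> 0"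
  shows expectation_le_sqrt_expectation_square:
      "expectation X \<le> sqrt (expectation (\<lambda>\<omega>. (X \<omega>)\<^sup>2))"
    and expectation_less_sqrt_expectation_square_iff:
      "expectation X < sqrt (expectation (\<lambda>\<omega>. (X \<omega>)\<^sup>2)) \<longleftrightarrow> \<not> (\<exists>c. AE \<omega> in M. X \<omega> = c)"
proof -
  have v: "variance X = expectation (\<lambda>\<omega>. (X \<omega>)\<^sup>2) - (expectation X)\<^sup>2"
    using X by (rule variance_eq)
  \<comment> \<open>This makes \<open>expectation X\<close> the root of its square, so the strict
    comparison passes to the squares, whose gap is the variance.\<close>
  have "0 \<le> expectation X"
    using nonneg by simp
  then have E: "sqrt ((expectation X)\<^sup>2) = expectation X"
    by simp
  have v0: "0 \<le> variance X"
    by (rule variance_positive)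
  show "expectation X \<le> sqrt (expectation (\<lambda>\<omega>. (X \<omega>)\<^sup>2))"
    using v v0 by (intro real_le_rsqrt) simp
  have "expectation X < sqrt (expectation (\<lambda>\<omega>. (X \<omega>)\<^sup>2)) \<longleftrightarrow>
      (expectation X)\<^sup>2 < expectation (\<lambda>\<omega>. (X \<omega>)\<^sup>2)"
    using real_sqrt_less_iff[of "(expectation X)\<^sup>2"] unfolding E .
  also have "\<dots> \<longleftrightarrow> variance X \<noteq> 0"
    using v v0 by linarith
  finally have "expectation X < sqrt (expectation (\<lambda>\<omega>. (X \<omega>)\<^sup>2)) \<longleftrightarrow> variance X \<noteq> 0" .
  then show "expectation X < sqrt (expectation (\<lambda>\<omega>. (X \<omega>)\<^sup>2)) \<longleftrightarrow>
      \<not> (\<exists>c. AE \<omega> in M. X \<omega> = c)"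
    using variance_eq_0_iff_AE_const[OF X] by simp
qed

end

text \<open>Strictness can fail: if both estimates are almost surely constant, the two bounds and
  the mean coincide. Hence the bounds are non-strict, each with an exact criterion for
  strictness.\<close>

theorem proposition3:
  fixes M :: "'a measure"
    and \<kappa> :: "'j::finite \<Rightarrow> 'v \<Rightarrow> real" and v :: 'v
    and \<phi> \<alpha> \<beta> :: "real ^ 'j"
    and a b x \<sigma> A :: real
    and e y A_hat :: "'a \<Rightarrow> real"
    and \<alpha>_hat \<beta>_hat :: "'a \<Rightarrow> real ^ 'j"
    and \<Sigma>\<^sub>\<alpha> \<Sigma>\<^sub>\<beta> :: "real ^ 'j ^ 'j"
  assumes "prob_space M"
    and "\<phi> = activation \<kappa> v"
    and "a = \<alpha> \<bullet> \<phi>" and "b = \<beta> \<bullet> \<phi>"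
    and "\<sigma> > 0" and "distributed M lborel e (normal_density 0 \<sigma>)"
    and "\<forall>\<omega>\<in>space M. y \<omega> = a * cos x + b * sin x + e \<omega>"
    and "unbiased_estimate M \<alpha>_hat \<alpha>" and "unbiased_estimate M \<beta>_hat \<beta>"
    and "has_covariance_matrix M \<alpha>_hat \<Sigma>\<^sub>\<alpha>" and "has_covariance_matrix M \<beta>_hat \<Sigma>\<^sub>\<beta>"
    and "A = amplitude \<phi> \<alpha> \<beta>"
    and "\<forall>\<omega>. A_hat \<omega> = amplitude \<phi> (\<alpha>_hat \<omega>) (\<beta>_hat \<omega>)"
  shows "A \<le> integral\<^sup>L M A_hat
    \<and> integral\<^sup>L M A_hat \<le> sqrt (A\<^sup>2 + \<phi> \<bullet> (\<Sigma>\<^sub>\<alpha> *v \<phi>) + \<phi> \<bullet> (\<Sigma>\<^sub>\<beta> *v \<phi>))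
    \<and> (A < integral\<^sup>L M A_hat \<longleftrightarrow> \<not> deterministic_phase M \<phi> \<alpha>_hat \<beta>_hat)
    \<and> (integral\<^sup>L M A_hat < sqrt (A\<^sup>2 + \<phi> \<bullet> (\<Sigma>\<^sub>\<alpha> *v \<phi>) + \<phi> \<bullet> (\<Sigma>\<^sub>\<beta> *v \<phi>))
         \<longleftrightarrow> \<not> deterministic_amplitude M \<phi> \<alpha>_hat \<beta>_hat)"
proof -
  interpret prob_space M by fact
  define P where "P = (\<lambda>\<omega>. \<alpha>_hat \<omega> \<bullet> \<phi>)"
  define Q where "Q = (\<lambda>\<omega>. \<beta>_hat \<omega> \<bullet> \<phi>)"
  have P: "integrable M P" "expectation P = \<alpha> \<bullet> \<phi>"
    and Q: "integrable M Q" "expectation Q = \<beta> \<bullet> \<phi>"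
    using assms(8,9) by (auto simp: P_def Q_def unbiased_estimate_def)
  have P2: "integrable M (\<lambda>\<omega>. (P \<omega>)\<^sup>2)"
    and Q2: "integrable M (\<lambda>\<omega>. (Q \<omega>)\<^sup>2)"
    unfolding P_def Q_def
    using integrable_square_inner[OF assms(10,8)] integrable_square_inner[OF assms(11,9)] by auto
  have R: "A_hat = (\<lambda>\<omega>. sqrt ((P \<omega>)\<^sup>2 + (Q \<omega>)\<^sup>2))"
    using assms(13) by (auto simp: amplitude_def P_def Q_def)
  have A: "A = sqrt ((expectation P)\<^sup>2 + (expectation Q)\<^sup>2)"
    using assms(12) P Q by (simp add: amplitude_def)
  have phase: "deterministic_phase M \<phi> \<alpha>_hat \<beta>_hat \<longleftrightarrow>
      (\<exists>\<psi>. AE \<omega> in M. P \<omega> = A_hat \<omega> * cos \<psi> \<and> Q \<omega> = A_hat \<omega> * sin \<psi>)"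
    using assms(13) by (simp add: deterministic_phase_def P_def Q_def)
  have ampl: "deterministic_amplitude M \<phi> \<alpha>_hat \<beta>_hat \<longleftrightarrow> (\<exists>c. AE \<omega> in M. A_hat \<omega> = c)"
    using assms(13) by (simp add: deterministic_amplitude_def)
  have A_hat: "integrable M A_hat" "integrable M (\<lambda>\<omega>. (A_hat \<omega>)\<^sup>2)" "\<And>\<omega>. A_hat \<omega> \<ge> 0"
    unfolding R using P Q P2 Q2 by (simp_all add: integrable_sqrt_sum_squares)
  \<comment> \<open>Squaring undoes the root and leaves no mixed term, so no cross-covariance of the
    two estimates appears.\<close>
  have "expectation (\<lambda>\<omega>. (A_hat \<omega>)\<^sup>2) = expectation (\<lambda>\<omega>. (P \<omega>)\<^sup>2) + expectation (\<lambda>\<omega>. (Q \<omega>)\<^sup>2)"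
    unfolding R using P2 Q2 by simp
  \<comment> \<open>The squared means subtracted in the two quadratic forms add up to
    \<open>A\<^sup>2\<close> and cancel against it.\<close>
  also have "\<dots> = A\<^sup>2 + \<phi> \<bullet> (\<Sigma>\<^sub>\<alpha> *v \<phi>) + \<phi> \<bullet> (\<Sigma>\<^sub>\<beta> *v \<phi>)"
    using covariance_quadratic_form[OF assms(10,8), of \<phi>]
      covariance_quadratic_form[OF assms(11,9), of \<phi>]
    by (simp add: A P Q) (simp add: P_def Q_def)
  finally have second_moment:
    "A\<^sup>2 + \<phi> \<bullet> (\<Sigma>\<^sub>\<alpha> *v \<phi>) + \<phi> \<bullet> (\<Sigma>\<^sub>\<beta> *v \<phi>) = expectation (\<lambda>\<omega>. (A_hat \<omega>)\<^sup>2)" ..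
  show ?thesis
    unfolding second_moment phase ampl
    using expectation_sqrt_sum_squares_ge[OF P(1) Q(1)]
      expectation_sqrt_sum_squares_greater_iff[OF P(1) Q(1)]
      expectation_le_sqrt_expectation_square[OF A_hat]
      expectation_less_sqrt_expectation_square_iff[OF A_hat]
    by (simp only: A R simp_thms)
qed

end
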